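(* In the standing setting described in the context, there exist constants $B_0,C_0$ such that for all $j\in\mathbb{N}$ and all $\vec x\in\mathbb{C}^d$, $$|m_0((A^\tau)^{-j}\vec x)|\le\Big(1+C_0\min\big(1,\tfrac{|\vec x|}{\beta^j}\big)\Big)\exp\Big(\tfrac{B_0|\mathfrak{Im}(\vec x)|}{\beta^j}\Big).$$
   Context: $\vec x\circ\vec y=\sum_j x_j\overline{y_j}$ for $\vec x,\vec y\in\mathbb{C}^d$; $|\cdot|$ is the Euclidean norm; $\mathfrak{Im}(\vec x)\in\mathbb{R}^d$ is the imaginary part of $\vec x$. $A^\tau$ is the transpose; expansive means all eigenvalues have modulus $>1$. $\beta=\|(A^\tau)^{-1}\|^{-1}$, where $\|\cdot\|$ is the operator norm on the Euclidean space $\mathbb{C}^d$. Standing setting: $A$ is a $d\times d$ expansive integral matrix with $|\det A|=2$ such that $A\mathbb{Z}^d=A^\tau\mathbb{Z}^d$, and $\vec\ell_A,\vec q_A\in\mathbb{Z}^d$ satisfy: $\mathbb{Z}^d=(\vec\ell_A+A\mathbb{Z}^d)\dot\cup A\mathbb{Z}^d$; $\vec q_A\circ A\mathbb{Z}^d\subseteq2\mathbb{Z}$, $\vec q_A\circ(\vec\ell_A+A\mathbb{Z}^d)\subseteq2\mathbb{Z}+1$; for $\vec m\in A\mathbb{Z}^d$, $\vec n\in\mathbb{Z}^d$: $\mathbb{Z}^d=(\vec n-A\mathbb{Z}^d)\dot\cup(\vec\ell_A-\vec m-\vec n+A\mathbb{Z}^d)$; for $\vec m\in\vec\ell_A+A\mathbb{Z}^d$,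 $\vec n\in\mathbb{Z}^d$: $\vec n-A\mathbb{Z}^d=\vec\ell_A-\vec m-\vec n+A\mathbb{Z}^d$. The complex numbers $\{h_{\vec n}\}$ satisfy $\sum_{\vec n}h_{\vec n}\overline{h_{\vec n+\vec k}}=\delta_{\vec0,\vec k}$ ($\vec k\in A\mathbb{Z}^d$), $\sum_{\vec n}h_{\vec n}=\sqrt2$, and vanish outside $\Lambda_0=\mathbb{Z}^d\cap[-N_0,N_0]^d$. $m_0(\vec t)=\frac1{\sqrt2}\sum_{\vec n\in\Lambda_0}h_{\vec n}e^{-i\vec n\circ\vec t}$ for $\vec t\in\mathbb{C}^d$. *)

theory Defs
  imports "HOL-Analysis.Analysis"
begin

text \<open>Complex dot product x \<circ> y = sum_j x_j * conj(y_j) on C^d.\<close>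
definition cdot :: "complex^'n::finite \<Rightarrow> complex^'n \<Rightarrow> complex" where
  "cdot x y = (\<Sum>i\<in>UNIV. x $ i * cnj (y $ i))"

text \<open>Dot product on Z^d (conjugation is trivial there).\<close>
definition idot :: "int^'n::finite \<Rightarrow> int^'n \<Rightarrow> int" where
  "idot x y = (\<Sum>i\<in>UNIV. x $ i * y $ i)"

definition cvec :: "int^'n::finite \<Rightarrow> complex^'n" where
  "cvec v = (\<chi> i. of_int (v $ i))"

definition cmat :: "int^'n::finite^'m::finite \<Rightarrow> complex^'n^'m" where
  "cmat M = map_matrix of_int M"

text \<open>Imaginary part of a vector in C^d, a vector in R^d.\<close>
definition vIm :: "complex^'n::finite \<Rightarrow> real^'n" where
  "vIm x = (\<chi> i. Im (x $ i))"

text \<open>The lattice A Z^d.\<close>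
definition lat :: "int^'n::finite^'n \<Rightarrow> (int^'n) set" where
  "lat A = range (\<lambda>m. A *v m)"

text \<open>Expansive: every (complex) eigenvalue has modulus > 1.\<close>
definition expansive :: "int^'n::finite^'n \<Rightarrow> bool" where
  "expansive A \<longleftrightarrow> (\<forall>c v. v \<noteq> 0 \<and> cmat A *v v = c *s v \<longrightarrow> 1 < cmod c)"

text \<open>Lambda_0 = Z^d \<inter> [-N0,N0]^d.\<close>
definition Lambda0 :: "nat \<Rightarrow> (int^'n::finite) set" where
  "Lambda0 N0 = {n. \<forall>i. \<bar>n $ i\<bar> \<le> int N0}"

definition m0 :: "(int^'n::finite \<Rightarrow> complex) \<Rightarrow> nat \<Rightarrow> complex^'n \<Rightarrow> complex" where
  "m0 h N0 t = (1 / sqrt 2) * (\<Sum>n\<in>Lambda0 N0. h n * exp (- \<i> * cdot (cvec n) t))"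

text \<open>beta = || (A^T)^{-1} ||^{-1}, operator norm on Euclidean C^d.\<close>
definition betaA :: "int^'n::finite^'n \<Rightarrow> real" where
  "betaA A = inverse (onorm (\<lambda>x::complex^'n. matrix_inv (cmat (transpose A)) *v x))"

end

theory Submission
  imports Defs
begin

text \<open>Write M = (A^\<tau>)^-1 and \<rho> = ||M|| = 1/\<beta>. Since M is a real matrix it maps imaginary
  parts to imaginary parts, so t = M^j x satisfies |t| \<le> \<rho>^j |x| and |Im t| \<le> \<rho>^j |Im x|.
  The trigonometric polynomial m0 has frequencies in [-N0,N0]^d, hence |m0 t| \<le> K exp (L |Im t|)
  with K = \<Sum>|h n|/\<surd>2 and L = d N0; and since m0 0 = 1, near the origin
  |m0 t| \<le> 1 + K e^L L |t|. Treating |t| \<ge> 1 and |t| < 1 separately gives the claim with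
  B0 = L and C0 = K + K e^L L.\<close>

lemma funpow_le_power_mult:
  fixes g :: "'a \<Rightarrow> real"
  assumes step: "\<And>v. g (f v) \<le> c * g v" and "0 \<le> c"
  shows "g ((f ^^ j) x) \<le> c ^ j * g x"
proof (induction j)
  case 0
  then show ?case by simp
next
  case (Suc j)
  have "g ((f ^^ Suc j) x) \<le> c * g ((f ^^ j) x)"
    using step by simp
  also have "\<dots> \<le> c * (c ^ j * g x)"
    using Suc.IH \<open>0 \<le> c\<close> by (rule mult_left_mono)
  finally show ?case by (simp add: mult.assoc)
qed

lemma det_cmat: "det (cmat (B::int^'n::finite^'n)) = of_int (det B)"
  by (simp add: det_def cmat_def of_int_sum of_int_prod)

lemma Im_matrix_inv_eq_0:
  fixes C :: "complex^'n::finite^'n"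
  assumes "invertible C" and real: "\<And>i k. Im (C$i$k) = 0"
  shows "Im (matrix_inv C $i$k) = 0"
proof -
  define M where "M = matrix_inv C"
  have M: "C ** M = mat 1 \<and> M ** C = mat 1"
    using assms(1) unfolding M_def matrix_inv_def invertible_def by (rule someI_ex)
  define Mc where "Mc = (\<chi> i k. cnj (M$i$k))"
  have "cnj (C$i$k) = C$i$k" for i k
    using real by (simp add: complex_eq_iff)
  then have "(C ** Mc) $ i $ k = cnj ((C ** M) $ i $ k)" for i k
    by (simp add: matrix_matrix_mult_def Mc_def)
  then have "C ** Mc = mat 1"
    using M by (simp add: vec_eq_iff mat_def)
  then have "Mc = M"
    using M by (metis matrix_mul_assoc matrix_mul_lid matrix_mul_rid)
  then have "cnj (M$i$k) = M$i$k"
    by (metis Mc_def vec_lambda_beta)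
  then show ?thesis
    unfolding M_def using Reals_cnj_iff complex_is_Real_iff by blast
qed

definition complex_of_real_vec :: "real^'n::finite \<Rightarrow> complex^'n" where
  "complex_of_real_vec u = (\<chi> i. complex_of_real (u$i))"

lemma norm_complex_of_real_vec [simp]: "norm (complex_of_real_vec u) = norm u"
  by (simp add: complex_of_real_vec_def norm_vec_def)

lemma vIm_matrix_vector_mult:
  fixes M :: "complex^'n::finite^'n"
  assumes "\<And>i k. Im (M$i$k) = 0"
  shows "complex_of_real_vec (vIm (M *v v)) = M *v complex_of_real_vec (vIm v)"
  unfolding vec_eq_iff complex_of_real_vec_def vIm_def matrix_vector_mult_def
  using assms by (simp add: Im_sum of_real_sum complex_eq_iff)

lemma norm_vIm_matrix_vector_mult_le:
  fixes M :: "complex^'n::finite^'n"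
  assumes "\<And>i k. Im (M$i$k) = 0"
  shows "norm (vIm (M *v v)) \<le> onorm ((*v) M) * norm (vIm v)"
  by (metis assms norm_complex_of_real_vec vIm_matrix_vector_mult
      onorm[OF matrix_vector_mul_bounded_linear])

lemma norm_funpow_matrix_vector_mult_le:
  fixes M :: "complex^'n::finite^'n"
  shows "norm (((*v) M ^^ j) x) \<le> onorm ((*v) M) ^ j * norm x"
  by (rule funpow_le_power_mult[OF onorm onorm_pos_le]; rule matrix_vector_mul_bounded_linear)

lemma norm_vIm_funpow_matrix_vector_mult_le:
  fixes M :: "complex^'n::finite^'n"
  assumes "\<And>i k. Im (M$i$k) = 0"
  shows "norm (vIm (((*v) M ^^ j) x)) \<le> onorm ((*v) M) ^ j * norm (vIm x)"
  using funpow_le_power_mult[of "\<lambda>v. norm (vIm v)" "(*v) M" "onorm ((*v) M)"]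
    norm_vIm_matrix_vector_mult_le[OF assms] onorm_pos_le[OF matrix_vector_mul_bounded_linear]
  by blast

lemma abs_Lambda0_nth_le: "n \<in> Lambda0 N0 \<Longrightarrow> \<bar>real_of_int (n$i)\<bar> \<le> real N0"
  unfolding Lambda0_def by (metis (mono_tags) mem_Collect_eq of_int_abs of_int_le_iff of_int_of_nat_eq)

lemma norm_cdot_cvec_le:
  assumes "n \<in> Lambda0 N0"
  shows "cmod (cdot (cvec n) (t::complex^'n::finite)) \<le> real CARD('n) * N0 * norm t"
proof -
  have "cmod (cdot (cvec n) t) \<le> (\<Sum>i\<in>UNIV. \<bar>real_of_int (n$i)\<bar> * cmod (t$i))"
    unfolding cdot_def cvec_def by (rule order_trans[OF norm_sum]) (simp add: norm_mult)
  also have "\<dots> \<le> (\<Sum>i\<in>(UNIV::'n set). real N0 * norm t)"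
    by (intro sum_mono mult_mono abs_Lambda0_nth_le[OF assms] Finite_Cartesian_Product.norm_nth_le) auto
  finally show ?thesis by simp
qed

lemma Re_minus_i_cdot_cvec_le:
  assumes "n \<in> Lambda0 N0"
  shows "Re (- \<i> * cdot (cvec n) (t::complex^'n::finite)) \<le> real CARD('n) * N0 * norm (vIm t)"
proof -
  have "Re (- \<i> * cdot (cvec n) t) = (\<Sum>i\<in>UNIV. - (of_int (n$i) * Im (t$i)))"
    unfolding cdot_def cvec_def by (simp add: Im_sum)
  also have "\<dots> \<le> (\<Sum>i\<in>UNIV. \<bar>real_of_int (n$i)\<bar> * \<bar>(vIm t)$i\<bar>)"
    by (intro sum_mono) (metis abs_ge_minus_self abs_mult vIm_def vec_lambda_beta)
  also have "\<dots> \<le> (\<Sum>i\<in>(UNIV::'n set). real N0 * norm (vIm t))"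
    by (intro sum_mono mult_mono abs_Lambda0_nth_le[OF assms] component_le_norm_cart) auto
  finally show ?thesis by simp
qed

lemma norm_m0_le_exp_norm_vIm:
  fixes t :: "complex^'n::finite" and N0 :: nat
  defines "L \<equiv> real CARD('n) * N0"
  shows "cmod (m0 h N0 t) \<le> (\<Sum>n\<in>Lambda0 N0. cmod (h n)) / sqrt 2 * exp (L * norm (vIm t))"
proof -
  have "cmod (\<Sum>n\<in>Lambda0 N0. h n * exp (- \<i> * cdot (cvec n) t))
     \<le> (\<Sum>n\<in>Lambda0 N0. cmod (h n) * exp (L * norm (vIm t)))"
  proof (rule order_trans[OF norm_sum sum_mono])
    fix n :: "int^'n" assume "n \<in> Lambda0 N0"
    then have "Re (- \<i> * cdot (cvec n) t) \<le> L * norm (vIm t)"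
      unfolding L_def by (rule Re_minus_i_cdot_cvec_le)
    then show "cmod (h n * exp (- \<i> * cdot (cvec n) t)) \<le> cmod (h n) * exp (L * norm (vIm t))"
      by (simp add: norm_mult norm_exp_eq_Re mult_left_mono del: mult_minus_left)
  qed
  then show ?thesis
    unfolding m0_def by (simp add: norm_divide sum_distrib_right divide_right_mono)
qed

lemma norm_m0_le_near_zero:
  fixes t :: "complex^'n::finite" and N0 :: nat
  defines "L \<equiv> real CARD('n) * N0"
  assumes sumh: "(\<Sum>n\<in>Lambda0 N0. h n) = complex_of_real (sqrt 2)"
    and "norm t \<le> 1"
  shows "cmod (m0 h N0 t) \<le> 1 + (\<Sum>n\<in>Lambda0 N0. cmod (h n)) / sqrt 2 * exp L * L * norm t"
proof -
  let ?e = "\<lambda>n. exp (- \<i> * cdot (cvec n) t)"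
  have "m0 h N0 t = (1 / sqrt 2) * ((\<Sum>n\<in>Lambda0 N0. h n) + (\<Sum>n\<in>Lambda0 N0. h n * (?e n - 1)))"
    unfolding m0_def by (simp add: sum.distrib[symmetric] algebra_simps)
  then have m0_eq: "m0 h N0 t = 1 + (\<Sum>n\<in>Lambda0 N0. h n * (?e n - 1)) / sqrt 2"
    using sumh by (simp add: add_divide_distrib)
  have "cmod (\<Sum>n\<in>Lambda0 N0. h n * (?e n - 1)) \<le> (\<Sum>n\<in>Lambda0 N0. cmod (h n) * (exp L * L * norm t))"
  proof (rule order_trans[OF norm_sum sum_mono])
    fix n :: "int^'n" assume "n \<in> Lambda0 N0"
    then have z: "cmod (- \<i> * cdot (cvec n) t) \<le> L * norm t"
      using norm_cdot_cvec_le unfolding L_def by (simp add: norm_mult)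
    also have "\<dots> \<le> L"
      using \<open>norm t \<le> 1\<close> L_def by (simp add: mult_left_le)
    \<comment> \<open>first-order Taylor bound \<open>|e\<^sup>z - 1| \<le> e\<^bsup>|z|\<^esup> |z|\<close>\<close>
    finally have "cmod (?e n - 1) \<le> exp L * (L * norm t)"
      using Taylor_exp_field[of "- \<i> * cdot (cvec n) t" 0] z
      by (simp add: order_trans[OF _ mult_mono])
    then show "cmod (h n * (?e n - 1)) \<le> cmod (h n) * (exp L * L * norm t)"
      by (simp add: norm_mult mult_left_mono mult.assoc)
  qed
  also have "\<dots> = (\<Sum>n\<in>Lambda0 N0. cmod (h n)) * (exp L * L * norm t)"
    by (simp add: sum_distrib_right)
  finally show ?thesis
    unfolding m0_eq
    by (intro order_trans[OF norm_triangle_ineq])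
       (simp add: norm_divide divide_right_mono mult.assoc)
qed

lemma norm_m0_le:
  fixes t :: "complex^'n::finite" and N0 :: nat and h :: "int^'n \<Rightarrow> complex"
  defines "L \<equiv> real CARD('n) * N0" and "K \<equiv> (\<Sum>n\<in>Lambda0 N0. cmod (h n)) / sqrt 2"
  assumes sumh: "(\<Sum>n\<in>Lambda0 N0. h n) = complex_of_real (sqrt 2)"
    and t: "norm t \<le> s" and Im_t: "norm (vIm t) \<le> r"
  shows "cmod (m0 h N0 t) \<le> (1 + (K + K * exp L * L) * min 1 s) * exp (L * r)"
proof -
  have K: "0 \<le> K"
    unfolding K_def by (simp add: sum_nonneg)
  have L: "0 \<le> L"
    unfolding L_def by simp
  have r: "0 \<le> r"
    using Im_t norm_ge_zero order_trans by blast
  have "0 \<le> s"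
    using t norm_ge_zero order_trans by blast
  have exp_Im: "exp (L * norm (vIm t)) \<le> exp (L * r)"
    using Im_t L by (simp add: mult_left_mono)
  show ?thesis
  proof (cases "1 \<le> s")
    case True
    have "cmod (m0 h N0 t) \<le> K * exp (L * r)"
      using norm_m0_le_exp_norm_vIm[of h N0 t] exp_Im K unfolding K_def L_def
      by (meson mult_left_mono order_trans)
    also have "\<dots> \<le> (1 + (K + K * exp L * L) * min 1 s) * exp (L * r)"
      using True K L by (intro mult_right_mono) auto
    finally show ?thesis .
  next
    case False
    then have "norm t \<le> 1" using t by simp
    have "K * exp L * L * norm t \<le> K * exp L * L * s"
      using t K L by (intro mult_left_mono) auto
    moreover have "0 \<le> K * s"
      using K \<open>0 \<le> s\<close> by simp
    ultimately have "K * exp L * L * norm t \<le> (K + K * exp L * L) * s"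
      by (simp add: distrib_right)
    then have "cmod (m0 h N0 t) \<le> 1 + (K + K * exp L * L) * min 1 s"
      using norm_m0_le_near_zero[OF sumh \<open>norm t \<le> 1\<close>] False unfolding K_def L_def by simp
    also have "\<dots> \<le> (1 + (K + K * exp L * L) * min 1 s) * exp (L * r)"
    proof -
      have "0 \<le> (K + K * exp L * L) * min 1 s"
        using K L \<open>0 \<le> s\<close> by simp
      moreover have "1 \<le> exp (L * r)"
        using L r by simp
      ultimately show ?thesis
        using mult_left_mono[of 1 "exp (L * r)" "1 + (K + K * exp L * L) * min 1 s"] by simp
    qed
    finally show ?thesis .
  qed
qed

theorem lemma8p4:
  fixes A :: "int^'n::finite^'n" and l q :: "int^'n"
    and h :: "int^'n \<Rightarrow> complex" and N0 :: nat
  assumes exp: "expansive A"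
    and det: "\<bar>det A\<bar> = 2"
    and latT: "lat A = lat (transpose A)"
    and split: "UNIV = ((+) l ` lat A) \<union> lat A" "((+) l ` lat A) \<inter> lat A = {}"
    and q_even: "\<forall>m\<in>lat A. even (idot q m)"
    and q_odd: "\<forall>m\<in>(+) l ` lat A. odd (idot q m)"
    and cond1: "\<forall>m\<in>lat A. \<forall>n.
        UNIV = ((\<lambda>k. n - k) ` lat A) \<union> ((\<lambda>k. l - m - n + k) ` lat A)
      \<and> ((\<lambda>k. n - k) ` lat A) \<inter> ((\<lambda>k. l - m - n + k) ` lat A) = {}"
    and cond2: "\<forall>m\<in>(+) l ` lat A. \<forall>n.
        (\<lambda>k. n - k) ` lat A = (\<lambda>k. l - m - n + k) ` lat A"
    and orth: "\<forall>k\<in>lat A. (\<Sum>n\<in>Lambda0 N0. h n * cnj (h (n + k))) = (if k = 0 then 1 else 0)"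
    and sumh: "(\<Sum>n\<in>Lambda0 N0. h n) = complex_of_real (sqrt 2)"
    and supp: "\<forall>n. n \<notin> Lambda0 N0 \<longrightarrow> h n = 0"
  shows "\<exists>B0 C0 :: real. \<forall>(j::nat) (x::complex^'n).
    cmod (m0 h N0 (((\<lambda>v. matrix_inv (cmat (transpose A)) *v v) ^^ j) x))
      \<le> (1 + C0 * min 1 (norm x / betaA A ^ j)) * exp (B0 * norm (vIm x) / betaA A ^ j)"
proof (intro exI allI)
  fix j :: nat and x :: "complex^'n"
  define M where "M = matrix_inv (cmat (transpose A))"
  have "invertible (cmat (transpose A))"
    unfolding invertible_det_nz det_cmat det_transpose using det by auto
  then have real: "Im (M$i$k) = 0" for i k
    unfolding M_def by (rule Im_matrix_inv_eq_0) (simp add: cmat_def)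
  have div_beta: "y / betaA A ^ j = onorm ((*v) M) ^ j * y" for y
    by (simp add: betaA_def M_def power_inverse divide_inverse mult.commute)
  let ?K = "(\<Sum>n\<in>Lambda0 N0. cmod (h n)) / sqrt 2" and ?L = "real CARD('n) * N0"
  have "cmod (m0 h N0 (((*v) M ^^ j) x))
      \<le> (1 + (?K + ?K * exp ?L * ?L) * min 1 (onorm ((*v) M) ^ j * norm x))
        * exp (?L * (onorm ((*v) M) ^ j * norm (vIm x)))"
    by (rule norm_m0_le[OF sumh norm_funpow_matrix_vector_mult_le
          norm_vIm_funpow_matrix_vector_mult_le[OF real]])
  then show "cmod (m0 h N0 (((\<lambda>v. matrix_inv (cmat (transpose A)) *v v) ^^ j) x))
      \<le> (1 + (?K + ?K * exp ?L * ?L) * min 1 (norm x / betaA A ^ j))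
        * exp (?L * norm (vIm x) / betaA A ^ j)"
    unfolding M_def[symmetric] div_beta by (simp add: mult.left_commute)
qed

end
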